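(* Let $r\in C^\infty(J)$ be an admissible function. The Lorentzian hypersurface $Q(r)\subset\mathbb{L}^{n+2}$ is totally umbilical if and only if $r(t)r''(t)+r'(t)^2=1$ for all $t\in J$; and this holds if and only if $$r(t)=\sqrt{t^2+at+b}\quad\text{for all } t\in J,$$ for some constants $a,b\in\mathbb{R}$ with $b>0$ and $a^2<4b$.
   Context: $\mathbb{L}^{n+2}$ is $\mathbb{R}^{n+2}$ with coordinates $(t,x)=(t,x_1,\dots,x_{n+1})$ and the Lorentzian metric $\langle\,,\rangle=-dt^2+dx_1^2+\dots+dx_{n+1}^2$. Let $J\subset\mathbb{R}$ be an open interval with $0\in J$. A function $r\in C^\infty(J)$ is called admissible if $r(t)>0$ and $|r'(t)|<1$ for all $t\in J$. For such $r$, $Q(r)=\{(t,x)\in J\times\mathbb{R}^{n+1}: x_1^2+\dots+x_{n+1}^2=r(t)^2\}$, a hypersurface of $\mathbb{L}^{n+2}$ whose induced metric is Lorentzian. Its unit spacelike normal vector field is $N(t,x)=\frac{1}{r(t)\sqrt{1-r'(t)^2}}\big(r'(t)r(t),x\big)$. The Weingarten operator is $A(V)=-\nabla^0_VN$ with $\nabla^0$ the Levi-Civita connection of $\mathbb{L}^{n+2}$; $Q(r)$ is totally umbilical if at every point $A$ is a multiple of the identity. *)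

theory Defs
  imports "HOL-Analysis.Analysis"
begin

text \<open>
  The space \<open>L^(n+2)\<close> is modelled on \<open>real \<times> (real ^ 'm)\<close> with \<open>CARD('m) = n + 1\<close>; the first
  component is the time coordinate.
\<close>

definition lorentz :: "real \<times> (real ^ 'm) \<Rightarrow> real \<times> (real ^ 'm) \<Rightarrow> real" where
  "lorentz v w = - (fst v * fst w) + snd v \<bullet> snd w"

text \<open>
  The coefficients of the Lorentzian metric are constant, so the Christoffel symbols of its
  Levi-Civita connection vanish in the standard coordinates: the covariant derivative of a vector
  field \<open>W\<close> in the direction \<open>V\<close> at \<open>p\<close> is the componentwise directional derivative.
\<close>

definition lc_connection ::
  "(real \<times> (real ^ 'm) \<Rightarrow> real \<times> (real ^ 'm)) \<Rightarrow> real \<times> (real ^ 'm) \<Rightarrow> real \<times> (real ^ 'm)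
    \<Rightarrow> real \<times> (real ^ 'm)" where
  "lc_connection W p V = frechet_derivative W (at p) V"

lemma lc_connection_metric:
  fixes W Z :: "real \<times> (real ^ 'm::finite) \<Rightarrow> real \<times> (real ^ 'm)"
  assumes "W differentiable (at p)" "Z differentiable (at p)"
  shows "((\<lambda>q. lorentz (W q) (Z q)) has_derivative
           (\<lambda>V. lorentz (lc_connection W p V) (Z p) + lorentz (W p) (lc_connection Z p V))) (at p)"
proof -
  have W: "(W has_derivative lc_connection W p) (at p)"
    and Z: "(Z has_derivative lc_connection Z p) (at p)"
    using assms unfolding lc_connection_def frechet_derivative_works by auto
  show ?thesis
    unfolding lorentz_def
    by (rule derivative_eq_intros W Z refl)+ (auto simp: algebra_simps inner_commute)
qed

text \<open>Infinite differentiability on an open set of reals.\<close>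

definition smooth_on :: "real set \<Rightarrow> (real \<Rightarrow> 'a::real_normed_vector) \<Rightarrow> bool" where
  "smooth_on S f \<longleftrightarrow>
     (\<forall>k. \<forall>t\<in>S. ((\<lambda>g s. vector_derivative g (at s)) ^^ k) f differentiable (at t))"

definition admissible :: "real set \<Rightarrow> (real \<Rightarrow> real) \<Rightarrow> bool" where
  "admissible J r \<longleftrightarrow> smooth_on J r \<and> (\<forall>t\<in>J. r t > 0 \<and> \<bar>deriv r t\<bar> < 1)"

definition Q :: "real set \<Rightarrow> (real \<Rightarrow> real) \<Rightarrow> (real \<times> (real ^ 'm)) set" where
  "Q J r = {(t, x). t \<in> J \<and> (\<Sum>i\<in>UNIV. (x $ i)\<^sup>2) = (r t)\<^sup>2}"

text \<open>
  The same formula extends the normal field along \<open>Q J r\<close> to the open set \<open>J \<times> UNIV\<close>; the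
  covariant derivative in directions tangent to \<open>Q J r\<close> does not depend on the extension.
\<close>

definition unit_normal :: "(real \<Rightarrow> real) \<Rightarrow> real \<times> (real ^ 'm) \<Rightarrow> real \<times> (real ^ 'm)" where
  "unit_normal r = (\<lambda>(t, x). (1 / (r t * sqrt (1 - (deriv r t)\<^sup>2))) *\<^sub>R (deriv r t * r t, x))"

text \<open>Velocities of smooth curves in \<open>S\<close> through \<open>p\<close>.\<close>

definition tangent_space :: "'a::real_normed_vector set \<Rightarrow> 'a \<Rightarrow> 'a set" where
  "tangent_space S p =
     {V. \<exists>\<gamma> \<epsilon>. \<epsilon> > 0 \<and> smooth_on {-\<epsilon><..<\<epsilon>} \<gamma> \<and> \<gamma> ` {-\<epsilon><..<\<epsilon>} \<subseteq> S \<and> \<gamma> 0 = p \<and>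
           (\<gamma> has_vector_derivative V) (at 0)}"

definition weingarten ::
  "(real \<times> (real ^ 'm) \<Rightarrow> real \<times> (real ^ 'm)) \<Rightarrow> real \<times> (real ^ 'm) \<Rightarrow> real \<times> (real ^ 'm)
    \<Rightarrow> real \<times> (real ^ 'm)" where
  "weingarten N p V = - lc_connection N p V"

definition totally_umbilical ::
  "(real \<times> (real ^ 'm)) set \<Rightarrow> (real \<times> (real ^ 'm) \<Rightarrow> real \<times> (real ^ 'm)) \<Rightarrow> bool" where
  "totally_umbilical S N \<longleftrightarrow>
     (\<forall>p\<in>S. \<exists>c. \<forall>V\<in>tangent_space S p. weingarten N p V = c *\<^sub>R V)"

lemma Q_iff: "(t, x) \<in> Q J r \<longleftrightarrow> t \<in> J \<and> x \<bullet> x = (r t)\<^sup>2"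
  by (simp add: Q_def inner_vec_def power2_eq_square)

lemma smooth_on_deriv_differentiable:
  fixes r :: "real \<Rightarrow> real"
  assumes "smooth_on J r" "t \<in> J"
  shows "r differentiable (at t)" "deriv r differentiable (at t)"
proof -
  have D: "\<forall>k. ((\<lambda>g s. vector_derivative g (at s)) ^^ k) r differentiable (at t)"
    using assms by (auto simp: smooth_on_def)
  show "r differentiable (at t)" using D[rule_format, of 0] by simp
  have "(\<lambda>s. vector_derivative r (at s)) = deriv r"
    by (auto simp: field_derivative_eq_vector_derivative)
  then show "deriv r differentiable (at t)" using D[rule_format, of 1] by simp
qed

lemma unit_normal_differentiable:
  fixes p :: "real \<times> (real ^ 'm::finite)"
  assumes "admissible J r" "fst p \<in> J"
  shows "unit_normal r differentiable (at p)"
proof -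
  obtain t x where p: "p = (t, x)" by (cases p)
  have r: "r t > 0" "\<bar>deriv r t\<bar> < 1" using assms p by (auto simp: admissible_def)
  have "(deriv r t)\<^sup>2 < 1" using r(2) by (simp add: abs_square_less_1)
  then have pos: "1 - (deriv r t)\<^sup>2 > 0" by simp
  obtain a b where ab: "(r has_real_derivative a) (at t)" "(deriv r has_real_derivative b) (at t)"
    using smooth_on_deriv_differentiable[of J r t] assms p
    unfolding admissible_def by (auto simp: real_differentiable_def)
  have g: "\<exists>d. ((\<lambda>t. 1 / (r t * sqrt (1 - (deriv r t)\<^sup>2))) has_real_derivative d) (at t)"
    by (rule exI, (rule derivative_eq_intros ab refl | use r pos in simp)+)
  then have g: "(\<lambda>t. 1 / (r t * sqrt (1 - (deriv r t)\<^sup>2))) differentiable (at t)"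
    by (simp add: real_differentiable_def)
  have c: "(\<lambda>q. f (fst q)) differentiable (at p)" if "f differentiable (at t)"
    for f :: "real \<Rightarrow> real"
    using differentiable_chain_at[of fst p f] that p bounded_linear_fst[THEN bounded_linear_imp_differentiable]
    by (auto simp: o_def)
  have 1: "(\<lambda>q. 1 / (r (fst q) * sqrt (1 - (deriv r (fst q))\<^sup>2))) differentiable (at p)"
    using c[OF g] .
  have "(\<lambda>t. deriv r t * r t) differentiable (at t)"
    using ab by (intro differentiable_mult) (auto simp: real_differentiable_def)
  note 2 = c[OF this]
  have 3: "snd differentiable (at p)"
    by (rule bounded_linear_imp_differentiable[OF bounded_linear_snd])
  have 4: "(\<lambda>q. (deriv r (fst q) * r (fst q), snd q)) differentiable (at p)"
    using 2 3 unfolding differentiable_def by (elim exE) (rule exI, rule has_derivative_Pair)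
  show ?thesis
    using differentiable_scaleR[OF 1 4] by (simp add: unit_normal_def case_prod_beta')
qed

lemma lorentz_unit_normal:
  fixes p :: "real \<times> (real ^ 'm::finite)"
  assumes "admissible J r" "p \<in> Q J r"
  shows "lorentz (unit_normal r p) (unit_normal r p) = 1"
proof -
  obtain t x where p: "p = (t, x)" by (cases p)
  have t: "t \<in> J" "x \<bullet> x = (r t)\<^sup>2" using assms p Q_iff by blast+
  have r: "r t > 0" "\<bar>deriv r t\<bar> < 1" using assms t by (auto simp: admissible_def)
  have "(deriv r t)\<^sup>2 < 1" using r(2) by (simp add: abs_square_less_1)
  then have pos: "1 - (deriv r t)\<^sup>2 > 0" by simp
  define c where "c = 1 / (r t * sqrt (1 - (deriv r t)\<^sup>2))"
  have "c\<^sup>2 * ((r t)\<^sup>2 * (1 - (deriv r t)\<^sup>2)) = 1"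
    using r pos by (simp add: c_def power_divide power_mult_distrib)
  moreover have "unit_normal r p = c *\<^sub>R (deriv r t * r t, x)"
    by (simp add: p unit_normal_def c_def)
  ultimately show ?thesis
    by (simp add: lorentz_def t power2_eq_square algebra_simps)
qed

lemma lorentz_unit_normal_tangent:
  fixes p :: "real \<times> (real ^ 'm::finite)"
  assumes "admissible J r" "p \<in> Q J r" "V \<in> tangent_space (Q J r) p"
  shows "lorentz (unit_normal r p) V = 0"
proof -
  obtain t x where p: "p = (t, x)" by (cases p)
  have t: "t \<in> J" using assms p Q_iff by blast
  obtain g e where g: "e > 0" "g ` {-e<..<e} \<subseteq> Q J r" "g 0 = p" "(g has_vector_derivative V) (at 0)"
    using assms(3) by (auto simp: tangent_space_def)
  have g': "(g has_derivative (\<lambda>h. h *\<^sub>R V)) (at 0)"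
    using g(4) by (simp add: has_vector_derivative_def)
  have "r differentiable (at t)"
    using assms(1) t smooth_on_deriv_differentiable unfolding admissible_def by blast
  then have "(r has_real_derivative deriv r t) (at t)"
    by (simp add: DERIV_deriv_iff_real_differentiable)
  then have r: "(r has_derivative (\<lambda>h. deriv r t * h)) (at (fst (g 0)))"
    by (simp add: g p has_field_derivative_def)
  have f: "((\<lambda>s. fst (g s)) has_derivative (\<lambda>h. fst (h *\<^sub>R V))) (at 0)"
    by (rule has_derivative_fst[OF g'])
  have s: "((\<lambda>s. snd (g s)) has_derivative (\<lambda>h. snd (h *\<^sub>R V))) (at 0)"
    by (rule has_derivative_snd[OF g'])
  have rg: "((\<lambda>s. r (fst (g s))) has_derivative (\<lambda>h. deriv r t * fst (h *\<^sub>R V))) (at 0)"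
    using has_derivative_compose[OF f r] .
  have "((\<lambda>s. snd (g s) \<bullet> snd (g s) - r (fst (g s)) * r (fst (g s))) has_derivative
          (\<lambda>h. (2 * (x \<bullet> snd V) - 2 * (r t * deriv r t * fst V)) * h)) (at 0)"
    by (rule derivative_eq_intros s rg refl)+
       (auto simp: g p fun_eq_iff algebra_simps inner_commute)
  moreover have "((\<lambda>s. snd (g s) \<bullet> snd (g s) - r (fst (g s)) * r (fst (g s))) has_derivative
          (\<lambda>h. 0)) (at 0)"
  proof (rule has_derivative_transform_within[OF has_derivative_const g(1)])
    fix s :: real assume "dist s 0 < e"
    then have "(fst (g s), snd (g s)) \<in> Q J r" using g(2) by (simp add: dist_real_def image_subset_iff abs_less_iff)
    then show "0 = snd (g s) \<bullet> snd (g s) - r (fst (g s)) * r (fst (g s))"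
      unfolding Q_iff by (simp add: power2_eq_square)
  qed simp
  ultimately have "(\<lambda>h. (2 * (x \<bullet> snd V) - 2 * (r t * deriv r t * fst V)) * h) = (\<lambda>h. 0)"
    by (rule has_derivative_unique)
  then have "(2 * (x \<bullet> snd V) - 2 * (r t * deriv r t * fst V)) * 1 = 0" by (rule fun_cong)
  then show ?thesis by (simp add: p unit_normal_def lorentz_def algebra_simps)
qed

end

theory Submission
  imports Defs
begin

text \<open>
  Write \<open>N = g (r' r, x)\<close> with \<open>g = 1 / (r sqrt (1 - r'^2))\<close>. Then \<open>(1 / g^2)' = 2 r r' (1 - \<rho>)\<close> with
  \<open>\<rho> = r r'' + r'^2\<close>, so \<open>\<rho> = 1\<close> makes \<open>g\<close> locally constant and the derivative of \<open>N\<close> becomes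
  \<open>g\<close> times the identity. Conversely, the rotational direction \<open>(0, y)\<close>, \<open>y\<close> orthogonal to \<open>x\<close>,
  has eigenvalue \<open>-g\<close>, and equating this with the eigenvalue of the meridian direction
  \<open>(1, (r' / r) x)\<close> yields first \<open>g' = 0\<close> and then \<open>\<rho> = 1\<close>. Finally \<open>2 \<rho> = (r^2)''\<close>, so \<open>\<rho> = 1\<close>
  says that \<open>r^2\<close> is a monic quadratic polynomial.
\<close>

subsection \<open>Smooth curves and tangent vectors\<close>

text \<open>It suffices to name a candidate \<open>D k\<close> for the derivative of each order.
  Agreement of \<open>f\<close> with \<open>D 0\<close> on the open set \<open>S\<close> passes on
  to all orders, since a derivative depends only on a neighbourhood of the point.\<close>

lemma smooth_onI:
  fixes D :: "nat \<Rightarrow> real \<Rightarrow> 'a::real_normed_vector"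
  assumes "open S" "\<And>t. t \<in> S \<Longrightarrow> f t = D 0 t"
    and D: "\<And>k t. t \<in> S \<Longrightarrow> (D k has_vector_derivative D (Suc k) t) (at t)"
  shows "smooth_on S f"
proof -
  let ?F = "\<lambda>k. ((\<lambda>g s. vector_derivative g (at s)) ^^ k) f"
  have transf: "(?F k has_vector_derivative D (Suc k) t) (at t)"
    if "\<And>s. s \<in> S \<Longrightarrow> ?F k s = D k s" "t \<in> S" for k t
    using has_vector_derivative_transform_within_open[OF D[OF that(2)] assms(1) that(2), of k "?F k"]
      that(1) by simp
  have eq: "\<forall>t\<in>S. ?F k t = D k t" for k
  proof (induction k)
    case 0
    then show ?case using assms(2) by simp
  next
    case (Suc k)
    then show ?case using transf[of k] by (simp add: vector_derivative_at)
  qed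
  show ?thesis
    unfolding smooth_on_def
  proof (intro allI ballI)
    fix k t assume "t \<in> S"
    then have "(?F k has_vector_derivative D (Suc k) t) (at t)" using transf[of k t] eq by blast
    then show "?F k differentiable (at t)" by (rule differentiableI_vector)
  qed
qed

lemma smooth_on_has_iterated_derivative:
  assumes "smooth_on S f" "t \<in> S"
  shows "(((\<lambda>g s. vector_derivative g (at s)) ^^ k) f has_vector_derivative
           ((\<lambda>g s. vector_derivative g (at s)) ^^ Suc k) f t) (at t)"
  using assms by (simp add: smooth_on_def vector_derivative_works)

text \<open>This is the initial velocity of the great circle \<open>cos s x + sin s y\<close> in the
  slice of constant time \<open>t\<close>. Orthogonality and equal lengths of \<open>x\<close> and
  \<open>y\<close> keep the curve on the sphere of radius \<open>r t\<close>.\<close>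

lemma rotation_in_tangent_space:
  fixes x y :: "real ^ 'm::finite"
  assumes "(t, x) \<in> Q J r" "x \<bullet> y = 0" "y \<bullet> y = x \<bullet> x"
  shows "(0, y) \<in> tangent_space (Q J r) (t, x)"
proof -
  \<comment> \<open>\<open>D k\<close> is the derivative of order \<open>k\<close> of the curve:
    each differentiation advances the phase by \<open>pi/2\<close>, and the constant time coordinate
    vanishes from order 1 on.\<close>
  define D where "D = (\<lambda>k s. (if k = 0 then t else 0,
      cos (s + real k * (pi/2)) *\<^sub>R x + sin (s + real k * (pi/2)) *\<^sub>R y))"
  have shift: "s + real (Suc k) * (pi/2) = (s + real k * (pi/2)) + pi/2" for s k
    by (simp add: algebra_simps)
  have D: "(D k has_vector_derivative D (Suc k) s) (at s)" for k s
  proof -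
    have phase: "cos (s + real (Suc k) * (pi/2)) = - sin (s + real k * (pi/2))"
      "sin (s + real (Suc k) * (pi/2)) = cos (s + real k * (pi/2))"
      by (simp_all only: shift cos_add[of _ "pi/2"] sin_add[of _ "pi/2"] cos_pi_half sin_pi_half
          mult_zero_right mult_1_right add_0_left add_0_right diff_0)
    have "((\<lambda>s. cos (s + c) *\<^sub>R x + sin (s + c) *\<^sub>R y) has_vector_derivative
        - sin (s + c) *\<^sub>R x + cos (s + c) *\<^sub>R y) (at s)" for c
      by (auto intro!: derivative_eq_intros)
    moreover have "((\<lambda>s. if k = 0 then t else 0) has_vector_derivative
        (if Suc k = 0 then t else 0)) (at s)"
      by simp
    ultimately show ?thesis unfolding D_def phase by (intro has_vector_derivative_Pair)
  qed
  have "D 0 s \<in> Q J r" for s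
  proof -
    have "(cos s *\<^sub>R x + sin s *\<^sub>R y) \<bullet> (cos s *\<^sub>R x + sin s *\<^sub>R y)
            = (cos s)\<^sup>2 * (x \<bullet> x) + (sin s)\<^sup>2 * (x \<bullet> x)"
      using assms(2,3) by (simp add: inner_add inner_commute power2_eq_square)
    also have "\<dots> = (r t)\<^sup>2"
      unfolding distrib_right[symmetric] sin_cos_squared_add2 using assms(1) by (simp add: Q_iff)
    moreover have "D 0 s = (t, cos s *\<^sub>R x + sin s *\<^sub>R y)" by (simp add: D_def)
    ultimately show ?thesis using assms(1) by (simp only: Q_iff)
  qed
  moreover have "smooth_on {-1<..<1} (D 0)"
    by (rule smooth_onI[where D = D]) (use D in auto)
  moreover have "D 0 0 = (t, x)" "D (Suc 0) 0 = (0, y)" by (simp_all add: D_def)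
  ultimately show ?thesis
    using D[of 0 0] unfolding tangent_space_def
    by (auto intro!: exI[of _ "D 0"] exI[of _ "1::real"])
qed

text \<open>The curve is the profile through \<open>(t, x)\<close>: time advances with unit speed
  while \<open>x\<close> is rescaled to length \<open>r (t + s)\<close>.\<close>

lemma meridian_in_tangent_space:
  fixes x :: "real ^ 'm::finite"
  assumes "open J" "admissible J r" "(t, x) \<in> Q J r"
  shows "(1, (deriv r t / r t) *\<^sub>R x) \<in> tangent_space (Q J r) (t, x)"
proof -
  have t: "t \<in> J" "x \<bullet> x = (r t)\<^sup>2" using assms(3) by (simp_all add: Q_iff)
  have r: "smooth_on J r" "r t > 0" using assms(2) t by (auto simp: admissible_def)
  obtain e where e: "e > 0" "ball t e \<subseteq> J" using assms(1) t(1) openE by blast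
  have J: "t + s \<in> J" if "s \<in> {-e<..<e}" for s
    using that e(2) by (auto simp: subset_iff dist_real_def)
  define R where "R = (\<lambda>k. ((\<lambda>g s. vector_derivative g (at s)) ^^ k) r)"
  \<comment> \<open>Again the derivatives of all orders of the curve; those of the time coordinate
    \<open>t + s\<close> are 1 and then 0.\<close>
  define D where "D = (\<lambda>k s. (if k = 0 then t + s else if k = 1 then 1 else 0,
      (R k (t + s) / r t) *\<^sub>R x))"
  have R: "(R k has_real_derivative R (Suc k) u) (at u)" if "u \<in> J" for k u
    using smooth_on_has_iterated_derivative[OF r(1) that]
    unfolding R_def has_real_derivative_iff_has_vector_derivative .
  have D: "(D k has_vector_derivative D (Suc k) s) (at s)" if "s \<in> {-e<..<e}" for k s
  proof -
    have "((\<lambda>s. R k (t + s)) has_real_derivative R (Suc k) (t + s)) (at s)"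
      using R[OF J[OF that], of k] DERIV_shift[of "R k" _ s t] by (simp add: add.commute)
    then have "((\<lambda>s. (R k (t + s) / r t) *\<^sub>R x) has_vector_derivative (R (Suc k) (t + s) / r t) *\<^sub>R x)
        (at s)"
      using r(2) by (auto intro!: derivative_eq_intros)
    moreover have "((\<lambda>s. if k = 0 then t + s else if k = 1 then 1 else 0) has_vector_derivative
        (if Suc k = 0 then t + s else if Suc k = 1 then 1 else 0)) (at s)"
      by (auto intro!: derivative_eq_intros simp: has_vector_derivative_def)
    ultimately show ?thesis unfolding D_def by (intro has_vector_derivative_Pair)
  qed
  have "D 0 s \<in> Q J r" if "s \<in> {-e<..<e}" for s
    using J[OF that] t r(2) by (simp add: D_def R_def Q_iff power2_eq_square)
  moreover have "smooth_on {-e<..<e} (D 0)"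
    by (rule smooth_onI[where D = D]) (use D in auto)
  moreover have "D 0 0 = (t, x)" using r(2) by (simp add: D_def R_def)
  moreover have "D (Suc 0) 0 = (1, (deriv r t / r t) *\<^sub>R x)"
    by (simp add: D_def R_def field_derivative_eq_vector_derivative)
  ultimately show ?thesis
    using D[of 0 0] e(1) unfolding tangent_space_def
    by (auto intro!: exI[of _ "D 0"] exI[of _ e])
qed

subsection \<open>The Weingarten operator\<close>

lemma admissible_derivatives:
  assumes "admissible J r" "t \<in> J"
  shows "(r has_real_derivative deriv r t) (at t)"
    and "(deriv r has_real_derivative deriv (deriv r) t) (at t)"
  using smooth_on_deriv_differentiable[of J r t] assms
  by (auto simp: admissible_def DERIV_deriv_iff_real_differentiable)

text \<open>The factor \<open>g\<close> of the overview as a function of time alone, so that its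
  derivative can be treated apart from that of the vector \<open>(r' r, x)\<close>.\<close>

definition normal_scale :: "(real \<Rightarrow> real) \<Rightarrow> real \<Rightarrow> real" where
  "normal_scale r t = 1 / (r t * sqrt (1 - (deriv r t)\<^sup>2))"

lemma admissible_one_minus_deriv_square_pos:
  assumes "admissible J r" "t \<in> J"
  shows "1 - (deriv r t)\<^sup>2 > 0"
  using assms by (simp add: admissible_def abs_square_less_1)

lemma normal_scale_pos:
  assumes "admissible J r" "t \<in> J"
  shows "normal_scale r t > 0"
  using assms admissible_one_minus_deriv_square_pos[OF assms] by (simp add: normal_scale_def admissible_def)

text \<open>The last factor is \<open>\<rho> - 1\<close>, as the derivative of
  \<open>1 / g^2\<close> predicts. The form exhibits that \<open>g\<close> is stationary wherever
  \<open>\<rho> = 1\<close>.\<close>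

lemma normal_scale_derivative:
  assumes "admissible J r" "t \<in> J"
  shows "(normal_scale r has_real_derivative
           normal_scale r t ^ 3 * r t * deriv r t * (r t * deriv (deriv r) t + (deriv r t)\<^sup>2 - 1)) (at t)"
proof -
  note d = admissible_derivatives[OF assms]
  have r: "r t > 0" using assms by (simp add: admissible_def)
  define w where "w = sqrt (1 - (deriv r t)\<^sup>2)"
  have w: "w > 0" "w\<^sup>2 = 1 - (deriv r t)\<^sup>2"
    using admissible_one_minus_deriv_square_pos[OF assms] by (simp_all add: w_def)
  have "((\<lambda>t. sqrt (1 - (deriv r t)\<^sup>2)) has_real_derivative
      - (deriv r t * deriv (deriv r) t) / w) (at t)"
    using admissible_one_minus_deriv_square_pos[OF assms] unfolding w_def
    by (auto intro!: derivative_eq_intros d simp: field_simps)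
  then have "((\<lambda>t. 1 / (r t * sqrt (1 - (deriv r t)\<^sup>2))) has_real_derivative
      - (deriv r t * w + r t * (- (deriv r t * deriv (deriv r) t) / w)) / (r t * w * (r t * w))) (at t)"
    by (rule DERIV_cong[OF DERIV_divide[OF DERIV_const DERIV_mult[OF d(1)]]])
      (use r w(1) in \<open>simp_all add: w_def[symmetric] algebra_simps\<close>)
  moreover have "- (deriv r t * w + r t * (- (deriv r t * deriv (deriv r) t) / w)) / (r t * w * (r t * w))
     = deriv r t * (r t * deriv (deriv r) t - w\<^sup>2) / (r t ^ 2 * w ^ 3)"
    using r w(1) by (simp add: field_simps power2_eq_square power3_eq_cube)
  moreover have "\<dots> = normal_scale r t ^ 3 * r t * deriv r t * (r t * deriv (deriv r) t + (deriv r t)\<^sup>2 - 1)"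
    \<comment> \<open>The numerator is written through \<open>deriv r t\<close>, whereas the root
      inside \<open>normal_scale\<close> is folded back to \<open>w\<close>, so that both sides have
      powers of \<open>r t\<close> and \<open>w\<close> as denominators.\<close>
    unfolding w(2) unfolding normal_scale_def w_def[symmetric]
    using r w(1) by (simp add: field_simps power2_eq_square power3_eq_cube)
  ultimately show ?thesis by (simp add: normal_scale_def[abs_def])
qed

text \<open>The product rule for \<open>g\<close> times \<open>(r' r, x)\<close>. The derivative
  \<open>d\<close> of \<open>g\<close> stays a parameter: one direction of the equivalence inserts
  0, the other deduces that it is 0.\<close>

lemma weingarten_unit_normal:
  fixes x v :: "real ^ 'm::finite"
  assumes "admissible J r" "t \<in> J"
    and g: "(normal_scale r has_real_derivative d) (at t)"
  shows "weingarten (unit_normal r) (t, x) (\<alpha>, v) =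
    - (normal_scale r t *\<^sub>R ((r t * deriv (deriv r) t + (deriv r t)\<^sup>2) * \<alpha>, v)
        + (d * \<alpha>) *\<^sub>R (deriv r t * r t, x))"
proof -
  have f: "((\<lambda>q. f (fst q)) has_derivative (\<lambda>V. f' * fst V)) (at (t, x))"
    if "(f has_real_derivative f') (at t)" for f f'
  proof -
    have "(f has_derivative (*) f') (at (fst (t, x)))"
      using that by (simp add: has_field_derivative_def)
    from has_derivative_compose[OF has_derivative_fst[OF has_derivative_ident] this]
    show ?thesis .
  qed
  have "((\<lambda>t. deriv r t * r t) has_real_derivative r t * deriv (deriv r) t + (deriv r t)\<^sup>2) (at t)"
    by (auto intro!: derivative_eq_intros admissible_derivatives[OF assms(1,2)]
        simp: power2_eq_square)
  note 2 = has_derivative_Pair[OF f[OF this] has_derivative_snd[OF has_derivative_ident]]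
  have "(unit_normal r has_derivative (\<lambda>V.
      normal_scale r t *\<^sub>R ((r t * deriv (deriv r) t + (deriv r t)\<^sup>2) * fst V, snd V)
        + (d * fst V) *\<^sub>R (deriv r t * r t, x))) (at (t, x))"
    using has_derivative_scaleR[OF f[OF g] 2]
    by (simp add: unit_normal_def normal_scale_def case_prod_beta')
  then show ?thesis
    unfolding weingarten_def lc_connection_def
    by (simp add: frechet_derivative_at[symmetric])
qed

lemma totally_umbilical_Q_iff:
  assumes "CARD('m::finite) \<ge> 2" "open J" "admissible J r"
  shows "totally_umbilical (Q J r :: (real \<times> (real ^ 'm)) set) (unit_normal r)
            \<longleftrightarrow> (\<forall>t\<in>J. r t * deriv (deriv r) t + (deriv r t)\<^sup>2 = 1)"
proof
  assume umb: "totally_umbilical (Q J r :: (real \<times> (real ^ 'm)) set) (unit_normal r)"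
  show "\<forall>t\<in>J. r t * deriv (deriv r) t + (deriv r t)\<^sup>2 = 1"
  proof
    fix t assume t: "t \<in> J"
    have r: "r t > 0" using assms(3) t by (simp add: admissible_def)
    obtain d where d: "(normal_scale r has_real_derivative d) (at t)"
      using normal_scale_derivative[OF assms(3) t] by blast
    define x :: "real ^ 'm" where "x = r t *\<^sub>R (SOME b. b \<in> Basis)"
    have x: "x \<bullet> x = (r t)\<^sup>2" by (simp add: x_def SOME_Basis power2_eq_square)
    \<comment> \<open>Dimension at least 2 provides a direction orthogonal to \<open>x\<close>; it
      is then rescaled to the length of \<open>x\<close>.\<close>
    obtain z :: "real ^ 'm" where z: "z \<noteq> 0" "orthogonal x z"
      using orthogonal_to_vector_exists[of x] assms(1) by auto
    define y where "y = (r t / norm z) *\<^sub>R z"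
    have "y \<bullet> y = (r t / norm z)\<^sup>2 * (norm z)\<^sup>2"
      unfolding y_def power2_norm_eq_inner by (simp add: power2_eq_square)
    then have y: "x \<bullet> y = 0" "y \<bullet> y = x \<bullet> x"
      using z by (simp_all add: y_def x orthogonal_def power_divide)
    have "(t, x) \<in> Q J r" using t x by (simp add: Q_iff)
    then obtain c where c: "weingarten (unit_normal r) (t, x) V = c *\<^sub>R V"
      if "V \<in> tangent_space (Q J r) (t, x)" for V
      using umb unfolding totally_umbilical_def by blast
    note c1 = c[OF rotation_in_tangent_space[OF \<open>(t, x) \<in> Q J r\<close> y],
        unfolded weingarten_unit_normal[OF assms(3) t d]]
    note c2 = c[OF meridian_in_tangent_space[OF assms(2,3) \<open>(t, x) \<in> Q J r\<close>],
        unfolded weingarten_unit_normal[OF assms(3) t d]]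
    have "y \<noteq> 0" "x \<noteq> 0" using x y r by auto
    \<comment> \<open>The time component of \<open>(0, y)\<close> is 0, which removes the terms
      containing \<open>\<rho>\<close> and \<open>d\<close>.\<close>
    have "c *\<^sub>R y = (- normal_scale r t) *\<^sub>R y" using c1 by simp
    then have c_eq: "c = - normal_scale r t" using \<open>y \<noteq> 0\<close> unfolding scaleR_cancel_right by simp
    \<comment> \<open>In the spatial component of the meridian equation the terms
      \<open>g (r' / r) x\<close> cancel.\<close>
    then have "d *\<^sub>R x = 0" using c2 by simp
    then have "d = 0" using \<open>x \<noteq> 0\<close> by simp
    \<comment> \<open>With \<open>d = 0\<close> the time component reads
      \<open>- g \<rho> = - g\<close>, and \<open>g\<close> is positive.\<close>
    then show "r t * deriv (deriv r) t + (deriv r t)\<^sup>2 = 1"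
      using c2 c_eq normal_scale_pos[OF assms(3) t] by simp
  qed
next
  assume \<rho>: "\<forall>t\<in>J. r t * deriv (deriv r) t + (deriv r t)\<^sup>2 = 1"
  show "totally_umbilical (Q J r :: (real \<times> (real ^ 'm)) set) (unit_normal r)"
    unfolding totally_umbilical_def
  proof (intro ballI exI)
    fix p V :: "real \<times> (real ^ 'm)" assume p: "p \<in> Q J r"
    obtain t x where tx: "p = (t, x)" by (cases p)
    obtain \<alpha> v where V: "V = (\<alpha>, v)" by (cases V)
    have t: "t \<in> J" using p by (simp add: tx Q_iff)
    have "(normal_scale r has_real_derivative 0) (at t)"
      using normal_scale_derivative[OF assms(3) t] \<rho> t by simp
    from weingarten_unit_normal[OF assms(3) t this]
    \<comment> \<open>The multiple has to be chosen from \<open>p\<close> alone, hence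
      \<open>fst p\<close> in place of \<open>t\<close>.\<close>
    show "weingarten (unit_normal r) p V = (- normal_scale r (fst p)) *\<^sub>R V"
      using \<rho> t by (simp add: tx V)
  qed
qed

subsection \<open>The differential equation\<close>

text \<open>The equation is integrated twice over the convex set \<open>J\<close>, with constants
  evaluated at 0. The bound \<open>a^2 < 4 * b\<close> expresses that the slope of \<open>r\<close>
  at 0 is less than 1 in absolute value.\<close>

lemma umbilicity_equation_imp_sqrt_quadratic:
  assumes "is_interval J" "0 \<in> J" "admissible J r"
    and \<rho>: "\<forall>t\<in>J. r t * deriv (deriv r) t + (deriv r t)\<^sup>2 = 1"
  shows "\<exists>a b. b > 0 \<and> a\<^sup>2 < 4 * b \<and> (\<forall>t\<in>J. r t = sqrt (t\<^sup>2 + a * t + b))"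
proof -
  note d = admissible_derivatives[OF assms(3)]
  have conv: "convex J" using assms(1) by (rule is_interval_convex)
  have r0: "r 0 > 0" using assms(2,3) by (simp add: admissible_def)
  \<comment> \<open>The derivative is \<open>\<rho> - 1\<close>.\<close>
  have "((\<lambda>t. r t * deriv r t - t) has_real_derivative 0) (at t within J)" if "t \<in> J" for t
    using \<rho> that d[OF that, THEN has_field_derivative_at_within]
    by (auto intro!: derivative_eq_intros simp: power2_eq_square algebra_simps)
  from has_field_derivative_zero_constant[OF conv this]
  obtain k where k: "\<forall>t\<in>J. r t * deriv r t - t = k" by auto
  have c: "r t * deriv r t = t + r 0 * deriv r 0" if "t \<in> J" for t
    using k[THEN bspec, OF that] k[THEN bspec, OF assms(2)] by simp
  \<comment> \<open>The derivative of \<open>r^2\<close> at 0; the constant term \<open>b\<close>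
    will be \<open>(r 0)^2\<close>.\<close>
  define a where "a = 2 * r 0 * deriv r 0"
  have "((\<lambda>t. (r t)\<^sup>2 - (t\<^sup>2 + a * t)) has_real_derivative 0) (at t within J)" if "t \<in> J" for t
    using c[OF that] d(1)[OF that, THEN has_field_derivative_at_within]
    by (auto intro!: derivative_eq_intros simp: a_def algebra_simps)
  from has_field_derivative_zero_constant[OF conv this]
  obtain k where k: "\<forall>t\<in>J. (r t)\<^sup>2 - (t\<^sup>2 + a * t) = k" by auto
  have sq: "(r t)\<^sup>2 = t\<^sup>2 + a * t + (r 0)\<^sup>2" if "t \<in> J" for t
    using k[THEN bspec, OF that] k[THEN bspec, OF assms(2)] by simp
  have "r t = sqrt (t\<^sup>2 + a * t + (r 0)\<^sup>2)" if "t \<in> J" for t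
    unfolding sq[OF that, symmetric] using assms(3) that by (auto simp: admissible_def less_imp_le)
  moreover have "a\<^sup>2 < 4 * (r 0)\<^sup>2"
    using admissible_one_minus_deriv_square_pos[OF assms(3,2)] r0 by (simp add: a_def power_mult_distrib)
  ultimately show ?thesis using r0 by (intro exI[of _ a] exI[of _ "(r 0)\<^sup>2"]) simp
qed

text \<open>Differentiating \<open>r^2\<close> and the quadratic polynomial gives
  \<open>r r' = t + a / 2\<close>; differentiating once more gives
  \<open>\<rho> = 1\<close>.\<close>

lemma sqrt_quadratic_imp_umbilicity_equation:
  assumes "open J" "admissible J r" "\<And>t. t \<in> J \<Longrightarrow> r t = sqrt (t\<^sup>2 + a * t + b)" "t \<in> J"
  shows "r t * deriv (deriv r) t + (deriv r t)\<^sup>2 = 1"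
proof -
  note d = admissible_derivatives[OF assms(2)]
  have sq: "t\<^sup>2 + a * t + b = (r t)\<^sup>2" if "t \<in> J" for t
  proof -
    \<comment> \<open>Admissibility makes the root positive; hence the radicand is positive and
      squaring recovers it.\<close>
    have "sqrt (t\<^sup>2 + a * t + b) > 0"
      using assms(2) assms(3)[OF that] that by (auto simp: admissible_def)
    then show ?thesis using assms(3)[OF that] by simp
  qed
  have first: "t + a / 2 = r t * deriv r t" if t: "t \<in> J" for t
  proof -
    have "((\<lambda>t. t\<^sup>2 + a * t + b) has_real_derivative 2 * r t * deriv r t) (at t)"
      \<comment> \<open>The formula for \<open>r\<close> is given on \<open>J\<close>, so the
        derivative is transferred within this open set.\<close>
      by (rule has_field_derivative_transform_within_open[where f = "\<lambda>t. (r t)\<^sup>2", OF _ assms(1) t])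
        (auto intro!: derivative_eq_intros d t simp: sq)
    moreover have "((\<lambda>t. t\<^sup>2 + a * t + b) has_real_derivative 2 * t + a) (at t)"
      by (auto intro!: derivative_eq_intros)
    ultimately show ?thesis using DERIV_unique by fastforce
  qed
  have "((\<lambda>t. t + a / 2) has_real_derivative r t * deriv (deriv r) t + (deriv r t)\<^sup>2) (at t)"
    by (rule has_field_derivative_transform_within_open[where f = "\<lambda>t. r t * deriv r t",
          OF _ assms(1,4)])
      (auto intro!: derivative_eq_intros d assms(4) simp: first power2_eq_square)
  moreover have "((\<lambda>t. t + a / 2) has_real_derivative 1) (at t)"
    by (auto intro!: derivative_eq_intros)
  ultimately show ?thesis using DERIV_unique by blast
qed

theorem mainTheorem6:
  fixes J :: "real set" and r :: "real \<Rightarrow> real" and n :: nat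
  assumes "n \<ge> 1" and "CARD('m::finite) = n + 1"
    and "open J" and "is_interval J" and "0 \<in> J"
    and "admissible J r"
  shows "(totally_umbilical (Q J r :: (real \<times> (real ^ 'm)) set) (unit_normal r)
            \<longleftrightarrow> (\<forall>t\<in>J. r t * deriv (deriv r) t + (deriv r t)\<^sup>2 = 1)) \<and>
         ((\<forall>t\<in>J. r t * deriv (deriv r) t + (deriv r t)\<^sup>2 = 1)
            \<longleftrightarrow> (\<exists>a b. b > 0 \<and> a\<^sup>2 < 4 * b \<and> (\<forall>t\<in>J. r t = sqrt (t\<^sup>2 + a * t + b))))"
proof (intro conjI)
  show "totally_umbilical (Q J r :: (real \<times> (real ^ 'm)) set) (unit_normal r)
          \<longleftrightarrow> (\<forall>t\<in>J. r t * deriv (deriv r) t + (deriv r t)\<^sup>2 = 1)"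
    \<comment> \<open>\<open>n \<ge> 1\<close> turns into the bound of 2 on the spatial
      dimension.\<close>
    using assms by (intro totally_umbilical_Q_iff) auto
  show "(\<forall>t\<in>J. r t * deriv (deriv r) t + (deriv r t)\<^sup>2 = 1)
          \<longleftrightarrow> (\<exists>a b. b > 0 \<and> a\<^sup>2 < 4 * b \<and> (\<forall>t\<in>J. r t = sqrt (t\<^sup>2 + a * t + b)))"
    using umbilicity_equation_imp_sqrt_quadratic[OF assms(4-6)]
      sqrt_quadratic_imp_umbilicity_equation[OF assms(3,6)] by blast
qed

end
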